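(* Let $F:\mathbb{R}\to\mathbb{R}$ satisfy $V F(V)\ge 0$ and $F(-V)=-F(V)$ for all $V$. Let $\mathcal{Q}^{\pm}(w^-,w^+)$ be functions such that, for all $w^-,w^+$, the quantities $v^\pm=\tfrac12(\mathcal{Q}^\pm+w^\pm)$ and $s^\pm=\tfrac12(\mathcal{Q}^\pm-w^\pm)$ satisfy the interface condition $s^-=-s^+=F(v^+-v^-)$. Let $\boldsymbol{u}^{\pm}(t)\in\mathbb{R}^{N+1}$ solve the two-block semidiscretization $$\ddot{\boldsymbol{u}}^{\pm}=\boldsymbol{D}_{11}\boldsymbol{u}^{\pm}+\sum_{k\in\{0,N\}}\Big(\boldsymbol{H}^{-1}\boldsymbol{e}_k\big(\tau_k^{\pm*}-n_k\boldsymbol{b}_k^T\boldsymbol{u}^{\pm}\big)-n_k\boldsymbol{H}^{-1}\boldsymbol{b}_k\big(u_k^{\pm*}-u_k^{\pm}\big)\Big),$$ where the numerical fluxes at the interface (index $N$ of block $-$ and index $0$ of block $+$) are the characteristic fluxes $$\dot u_N^{-*}=\frac{q_N^{-*}+w_N^{-*}}{2},\quad \tau_N^{-*}=\frac{q_N^{-*}-w_N^{-*}}{2},\quad \dot u_0^{+*}=\frac{q_0^{+*}+w_0^{+*}}{2},\quad \tau_0^{+*}=\frac{q_0^{+*}-w_0^{+*}}{2},$$ $$w_N^{-*}=\dot u_N^- -\tau_N^-,\quad w_0^{+*}=\dot u_0^+-\tau_0^+,\quad q_N^{-*}=\mathcal{Q}^-(w_N^{-*},w_0^{+*}),\quad q_0^{+*}=\mathcal{Q}^+(w_N^{-*},w_0^{+*}),$$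 with $\tau_k^{\pm}=n_k\boldsymbol{b}_k^T\boldsymbol{u}^{\pm}+\gamma(u_k^{\pm*}-u_k^{\pm})$. Then the interface term $$IT=\dot u_N^{-*}\tau_N^{-*}-(\dot u_N^--\dot u_N^{-*})(\tau_N^--\tau_N^{-*})+\dot u_0^{+*}\tau_0^{+*}-(\dot u_0^+-\dot u_0^{+*})(\tau_0^+-\tau_0^{+*})$$ satisfies $IT\le 0$.
   Context: One-dimensional summation-by-parts (SBP) setting: each block ($-$ for $[-1,0]$, $+$ for $[0,1]$) has $N+1$ equally spaced grid points indexed $0,\dots,N$ ($N\ge 1$); the interface $x=0$ is index $N$ of block $-$ and index $0$ of block $+$. $\boldsymbol{e}_k\in\mathbb{R}^{N+1}$ is the vector equal to $1$ at grid point $k$ and $0$ elsewhere, and $u_k^\pm=\boldsymbol{e}_k^T\boldsymbol{u}^\pm$. $\boldsymbol{H}$ is a diagonal positive definite matrix. $\boldsymbol{D}_{11}$ is an SBP second derivative operator: $\boldsymbol{H}\boldsymbol{D}_{11}=-\boldsymbol{A}_{11}+\boldsymbol{e}_N\boldsymbol{b}_N^T-\boldsymbol{e}_0\boldsymbol{b}_0^T$ with $\boldsymbol{A}_{11}$ symmetric positive semidefinite and $\boldsymbol{b}_0,\boldsymbol{b}_N\in\mathbb{R}^{N+1}$ boundary derivative vectors. The outward normals of each block are $n_0=-1$, $n_N=1$. $\gamma>0$ is a penalty parameter. Dots denote time derivatives. The fluxes $u_N^{-*},u_0^{+*}$ are additional unknowns evolved in time. The fluxes at the outer boundary points (index $0$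 of block $-$, index $N$ of block $+$) are not restricted here. *)

theory Defs
  imports "HOL-Analysis.Analysis"
begin

text \<open>
  Grid vectors of a block live in \<^typ>\<open>real^'n\<close>, where an enumeration \<open>pt\<close>, a bijection from
  \<open>{0..N}\<close> onto the index type, names the grid points \<open>0, \<dots>, N\<close>. Objects that exist only at
  the two end points (boundary derivative vectors, numerical fluxes) are functions of the
  numerical index \<open>k\<close> and are only ever evaluated at \<open>k = 0\<close> and \<open>k = N\<close>.
\<close>

definition grid_vec :: "(nat \<Rightarrow> 'n::finite) \<Rightarrow> nat \<Rightarrow> real^'n" where
  "grid_vec pt k = axis (pt k) 1"

definition grid_val :: "(nat \<Rightarrow> 'n::finite) \<Rightarrow> nat \<Rightarrow> real^'n \<Rightarrow> real" where
  "grid_val pt k u = grid_vec pt k \<bullet> u"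

definition outer_product :: "real^'n \<Rightarrow> real^'n \<Rightarrow> real^'n^'n" where
  "outer_product x y = (\<chi> i j. x $ i * y $ j)"

definition diagonal_matrix :: "real^'n^'n \<Rightarrow> bool" where
  "diagonal_matrix M \<longleftrightarrow> (\<forall>i j. i \<noteq> j \<longrightarrow> M $ i $ j = 0)"

definition symmetric_matrix :: "real^'n^'n \<Rightarrow> bool" where
  "symmetric_matrix M \<longleftrightarrow> transpose M = M"

definition positive_definite :: "real^'n^'n \<Rightarrow> bool" where
  "positive_definite M \<longleftrightarrow> symmetric_matrix M \<and> (\<forall>x. x \<noteq> 0 \<longrightarrow> 0 < x \<bullet> (M *v x))"

definition positive_semidefinite :: "real^'n^'n \<Rightarrow> bool" where
  "positive_semidefinite M \<longleftrightarrow> symmetric_matrix M \<and> (\<forall>x. 0 \<le> x \<bullet> (M *v x))"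

definition sbp_second_derivative ::
  "nat \<Rightarrow> (nat \<Rightarrow> 'n::finite) \<Rightarrow> real^'n^'n \<Rightarrow> real^'n^'n \<Rightarrow> (nat \<Rightarrow> real^'n) \<Rightarrow> bool" where
  "sbp_second_derivative N pt H D b \<longleftrightarrow>
     (\<exists>A. positive_semidefinite A \<and>
       H ** D = - A + outer_product (grid_vec pt N) (b N) - outer_product (grid_vec pt 0) (b 0))"

definition outward_normal :: "nat \<Rightarrow> real" where
  "outward_normal k = (if k = 0 then -1 else 1)"

definition traction ::
  "(nat \<Rightarrow> 'n::finite) \<Rightarrow> (nat \<Rightarrow> real^'n) \<Rightarrow> real \<Rightarrow> nat \<Rightarrow> real^'n \<Rightarrow> real \<Rightarrow> real" where
  "traction pt b \<gamma> k u us =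
     outward_normal k * (b k \<bullet> u) + \<gamma> * (us - grid_val pt k u)"

text \<open>
  Right-hand side of the semidiscretization on one block; \<open>us k\<close> and \<open>\<tau>s k\<close> are the numerical
  fluxes at the end point \<open>k\<close>.
\<close>

definition semidiscrete_rhs ::
  "nat \<Rightarrow> (nat \<Rightarrow> 'n::finite) \<Rightarrow> real^'n^'n \<Rightarrow> real^'n^'n \<Rightarrow> (nat \<Rightarrow> real^'n) \<Rightarrow>
    real^'n \<Rightarrow> (nat \<Rightarrow> real) \<Rightarrow> (nat \<Rightarrow> real) \<Rightarrow> real^'n" where
  "semidiscrete_rhs N pt H D b u us \<tau>s =
     D *v u +
     (\<Sum>k\<in>{0, N}.
        (\<tau>s k - outward_normal k * (b k \<bullet> u)) *\<^sub>R (matrix_inv H *v grid_vec pt k)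
        - (outward_normal k * (us k - grid_val pt k u)) *\<^sub>R (matrix_inv H *v b k))"

text \<open>
  \<open>F\<close> is the interface law; \<open>Qm\<close> and \<open>Qp\<close> are the two components of the characteristic map.
\<close>

definition interface_condition ::
  "(real \<Rightarrow> real) \<Rightarrow> (real \<Rightarrow> real \<Rightarrow> real) \<Rightarrow> (real \<Rightarrow> real \<Rightarrow> real) \<Rightarrow> bool" where
  "interface_condition F Qm Qp \<longleftrightarrow>
     (\<forall>wm wp.
        let vm = (Qm wm wp + wm) / 2; vp = (Qp wm wp + wp) / 2;
            sm = (Qm wm wp - wm) / 2; sp = (Qp wm wp - wp) / 2
        in sm = - sp \<and> - sp = F (vp - vm))"

end

theory Submission
  imports Defs
begin

text \<open>
  The claim is pointwise in time and rests on two features of the characteristic fluxes.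

  A numerical flux pair and the grid quantities that produced it share the same characteristic
  variable \<open>w\<close>: velocity minus traction is \<open>w\<close> for both. Hence on each side the velocity mismatch
  equals the traction mismatch, and their product, which enters the interface term with a minus
  sign, is a square (\<open>mismatch_product_nonneg\<close>). Thus the numerical dissipation has the right sign
  whatever the grid solution is.

  What is left is the power of the numerical fluxes at the interface. These satisfy the interface
  law exactly: the two tractions are equal and opposite, so only the velocity jump \<open>V\<close> does work,
  and the power is \<open>- V F(V)\<close>, which is not positive because \<open>F\<close> opposes sliding
  (\<open>interface_power_nonpos\<close>).
\<close>

lemma mismatch_product_nonneg:
  fixes v \<tau> vs \<tau>s :: real
  assumes "v - \<tau> = vs - \<tau>s"
  shows "0 \<le> (v - vs) * (\<tau> - \<tau>s)"
proof -
  have "\<tau> - \<tau>s = v - vs"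
    using assms by linarith
  then show ?thesis
    by simp
qed

text \<open>
  Action and reaction at the interface: with tractions \<open>F V\<close> and \<open>- F V\<close> on the two sides, the total
  power \<open>vm * F V - vp * F V\<close> depends on the velocities only through the jump \<open>V = vp - vm\<close>.
\<close>

lemma interface_power_nonpos:
  assumes dissipative: "\<forall>V. 0 \<le> V * F V"
    and "interface_condition F Qm Qp"
  shows "(Qm wm wp + wm) / 2 * ((Qm wm wp - wm) / 2)
       + (Qp wm wp + wp) / 2 * ((Qp wm wp - wp) / 2) \<le> 0"
proof -
  define vm vp sm sp where defs: "vm = (Qm wm wp + wm) / 2" "vp = (Qp wm wp + wp) / 2"
    "sm = (Qm wm wp - wm) / 2" "sp = (Qp wm wp - wp) / 2"
  have "sm = - sp \<and> - sp = F (vp - vm)"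
    using assms(2) unfolding interface_condition_def Let_def defs by blast
  then have "sm = F (vp - vm)" "sp = - F (vp - vm)"
    by auto
  then have "vm * sm + vp * sp = - ((vp - vm) * F (vp - vm))"
    by (simp add: algebra_simps)
  also have "\<dots> \<le> 0"
    using dissipative by simp
  finally show ?thesis
    unfolding defs .
qed

theorem theorem6:
  fixes N :: nat and pt :: "nat \<Rightarrow> 'n::finite"
    and H D :: "real^'n^'n" and b :: "nat \<Rightarrow> real^'n" and \<gamma> :: real
    and F :: "real \<Rightarrow> real" and Qm Qp :: "real \<Rightarrow> real \<Rightarrow> real"
    and T :: "real set"
    and um dum up dup :: "real \<Rightarrow> real^'n"
    and usm \<tau>sm \<tau>m usp \<tau>sp \<tau>p :: "nat \<Rightarrow> real \<Rightarrow> real"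
    and dusm dusp wm wp qm qp :: "real \<Rightarrow> real"
  assumes "1 \<le> N" and "bij_betw pt {0..N} UNIV"
    and "diagonal_matrix H" and "positive_definite H"
    and "sbp_second_derivative N pt H D b"
    and "0 < \<gamma>"
    and "\<forall>V. 0 \<le> V * F V" and "\<forall>V. F (- V) = - F V"
    and "interface_condition F Qm Qp"
    and "is_interval T" and "interior T \<noteq> {}"
    and "\<forall>t\<in>T. (um has_vector_derivative dum t) (at t within T)"
    and "\<forall>t\<in>T. (up has_vector_derivative dup t) (at t within T)"
    and "\<forall>t\<in>T. (dum has_vector_derivative
           semidiscrete_rhs N pt H D b (um t) (\<lambda>k. usm k t) (\<lambda>k. \<tau>sm k t)) (at t within T)"
    and "\<forall>t\<in>T. (dup has_vector_derivative
           semidiscrete_rhs N pt H D b (up t) (\<lambda>k. usp k t) (\<lambda>k. \<tau>sp k t)) (at t within T)"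
    and "\<forall>t\<in>T. \<forall>k\<in>{0, N}. \<tau>m k t = traction pt b \<gamma> k (um t) (usm k t)"
    and "\<forall>t\<in>T. \<forall>k\<in>{0, N}. \<tau>p k t = traction pt b \<gamma> k (up t) (usp k t)"
    and "\<forall>t\<in>T. wm t = grid_val pt N (dum t) - \<tau>m N t"
    and "\<forall>t\<in>T. wp t = grid_val pt 0 (dup t) - \<tau>p 0 t"
    and "\<forall>t\<in>T. qm t = Qm (wm t) (wp t)"
    and "\<forall>t\<in>T. qp t = Qp (wm t) (wp t)"
    and "\<forall>t\<in>T. (usm N has_real_derivative dusm t) (at t within T)"
    and "\<forall>t\<in>T. (usp 0 has_real_derivative dusp t) (at t within T)"
    and "\<forall>t\<in>T. dusm t = (qm t + wm t) / 2" and "\<forall>t\<in>T. \<tau>sm N t = (qm t - wm t) / 2"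
    and "\<forall>t\<in>T. dusp t = (qp t + wp t) / 2" and "\<forall>t\<in>T. \<tau>sp 0 t = (qp t - wp t) / 2"
  shows "\<forall>t\<in>T.
      dusm t * \<tau>sm N t - (grid_val pt N (dum t) - dusm t) * (\<tau>m N t - \<tau>sm N t)
      + dusp t * \<tau>sp 0 t - (grid_val pt 0 (dup t) - dusp t) * (\<tau>p 0 t - \<tau>sp 0 t) \<le> 0"
proof
  fix t
  assume t: "t \<in> T"
  have "dusm t * \<tau>sm N t + dusp t * \<tau>sp 0 t \<le> 0"
    unfolding assms(20,21,24-27)[rule_format, OF t] by (rule interface_power_nonpos[OF assms(7,9)])
  \<comment> \<open>On each side both differences below equal the characteristic variable \<open>w\<close>.\<close>
  moreover have "grid_val pt N (dum t) - \<tau>m N t = dusm t - \<tau>sm N t"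
    using assms(18,24,25)[rule_format, OF t] by argo
  then have "0 \<le> (grid_val pt N (dum t) - dusm t) * (\<tau>m N t - \<tau>sm N t)"
    by (rule mismatch_product_nonneg)
  moreover have "grid_val pt 0 (dup t) - \<tau>p 0 t = dusp t - \<tau>sp 0 t"
    using assms(19,26,27)[rule_format, OF t] by argo
  then have "0 \<le> (grid_val pt 0 (dup t) - dusp t) * (\<tau>p 0 t - \<tau>sp 0 t)"
    by (rule mismatch_product_nonneg)
  ultimately show "dusm t * \<tau>sm N t - (grid_val pt N (dum t) - dusm t) * (\<tau>m N t - \<tau>sm N t)
      + dusp t * \<tau>sp 0 t - (grid_val pt 0 (dup t) - dusp t) * (\<tau>p 0 t - \<tau>sp 0 t) \<le> 0"
    by linarith
qed

end
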